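(* Let $M_R,M_T\ge1$ be integers and $\rho_1,\rho_2$ real with $|\rho_1|<1$, $|\rho_2|<1$. Let $z_0$, $z_{i1}$ ($2\le i\le M_R$), $z_{1j}$ ($2\le j\le M_T$), $z_{ij}$ ($2\le i\le M_R$, $2\le j\le M_T$) be independent circularly symmetric complex Gaussian random variables with mean $0$ and variance $1$ (i.e. $\mathbb{E}|z|^2=1$), and for $2\le i\le M_R$, $2\le j\le M_T$ put $$h_{11}=z_0,\quad h_{i1}=\sqrt{1-\rho_1^2}\,z_{i1}+\rho_1z_0,\quad h_{1j}=\sqrt{1-\rho_2^2}\,z_{1j}+\rho_2z_0,\quad h_{ij}=\sqrt{1-\rho_1^2\rho_2^2}\,z_{ij}+\rho_1\rho_2z_0 .$$ Let $|h_{\rm FAS}|=\max_{1\le i\le M_R,\,1\le j\le M_T}|h_{ij}|$ and $P_{\rm out}(\gamma_{th})=\Pr(|h_{\rm FAS}|^2<\gamma_{th})$. Then for every $\gamma_{th}>0$, $$\begin{aligned}P_{\rm out}(\gamma_{th})\ge\left(1-e^{-\gamma_{th}}\right)&\left(1-Q_1\!\left(\sqrt{\tfrac{2\rho_1^2\gamma_{th}}{1-\rho_1^2}},\sqrt{\tfrac{2\gamma_{th}}{1-\rho_1^2}}\right)\right)^{M_R-1}\left(1-Q_1\!\left(\sqrt{\tfrac{2\rho_2^2\gamma_{th}}{1-\rho_2^2}},\sqrt{\tfrac{2\gamma_{th}}{1-\rho_2^2}}\right)\right)^{M_T-1}\\&\times\left(1-Q_1\!\left(\sqrt{\tfrac{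2\rho_1^2\rho_2^2\gamma_{th}}{1-\rho_1^2\rho_2^2}},\sqrt{\tfrac{2\gamma_{th}}{1-\rho_1^2\rho_2^2}}\right)\right)^{(M_R-1)(M_T-1)}.\end{aligned}$$
   Context: $Q_1(a,b)=\int_b^\infty x\,e^{-\frac{x^2+a^2}{2}}I_0(ax)\,dx$ ($a,b\ge0$) is the first-order Marcum $Q$-function, with $I_0$ the modified Bessel function of the first kind of order $0$. *)

theory Defs
  imports "HOL-Probability.Probability"
begin

definition bessel_I :: "nat \<Rightarrow> real \<Rightarrow> real" where
  "bessel_I n x = (\<Sum>k. (x / 2) ^ (2 * k + n) / (fact k * fact (k + n)))"

definition marcum_Q1 :: "real \<Rightarrow> real \<Rightarrow> real" where
  "marcum_Q1 a b =
     (LINT x:{b..}|lborel. x * exp (- ((x\<^sup>2 + a\<^sup>2) / 2)) * bessel_I 0 (a * x))"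

text \<open>
  Zero mean is built in. The parameter \<open>v\<close> is the total variance, i.e. the expectation of the
  squared modulus, so each of the two real components has variance \<open>v / 2\<close>; note that
  \<^const>\<open>normal_density\<close> takes the standard deviation as its second argument.
\<close>

definition circ_sym_complex_gaussian :: "'a measure \<Rightarrow> real \<Rightarrow> ('a \<Rightarrow> complex) \<Rightarrow> bool" where
  "circ_sym_complex_gaussian M v Z \<longleftrightarrow>
     0 < v \<and>
     prob_space.indep_var M borel (\<lambda>\<omega>. Re (Z \<omega>)) borel (\<lambda>\<omega>. Im (Z \<omega>)) \<and>
     distributed M lborel (\<lambda>\<omega>. Re (Z \<omega>)) (\<lambda>x. ennreal (normal_density 0 (sqrt (v / 2)) x)) \<and>
     distributed M lborel (\<lambda>\<omega>. Im (Z \<omega>)) (\<lambda>x. ennreal (normal_density 0 (sqrt (v / 2)) x))"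

lemma (in prob_space) circ_sym_complex_gaussian_moments:
  assumes "circ_sym_complex_gaussian M v Z"
  shows "integrable M Z" and "expectation (\<lambda>\<omega>. Re (Z \<omega>)) = 0" and "expectation (\<lambda>\<omega>. Im (Z \<omega>)) = 0"
    and "integrable M (\<lambda>\<omega>. (cmod (Z \<omega>))\<^sup>2)" and "expectation (\<lambda>\<omega>. (cmod (Z \<omega>))\<^sup>2) = v"
proof -
  define s where "s = sqrt (v / 2)"
  have v: "0 < v" and s: "0 < s" and s2: "s\<^sup>2 = v / 2"
    using assms by (auto simp: circ_sym_complex_gaussian_def s_def)
  have dR: "distributed M lborel (\<lambda>\<omega>. Re (Z \<omega>)) (\<lambda>x. ennreal (normal_density 0 s x))"
    and dI: "distributed M lborel (\<lambda>\<omega>. Im (Z \<omega>)) (\<lambda>x. ennreal (normal_density 0 s x))"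
    using assms by (simp_all add: circ_sym_complex_gaussian_def s_def)
  have component: "integrable M X \<and> expectation X = 0 \<and>
      integrable M (\<lambda>\<omega>. (X \<omega>)\<^sup>2) \<and> expectation (\<lambda>\<omega>. (X \<omega>)\<^sup>2) = v / 2"
    if d: "distributed M lborel X (\<lambda>x. ennreal (normal_density 0 s x))" for X :: "'a \<Rightarrow> real"
  proof -
    have "integrable M X"
      using distributed_integrable[OF d, of "\<lambda>x. x"] integrable_normal_moment_nz_1[OF s, of 0] by simp
    moreover have e: "expectation X = 0"
      by (rule normal_distributed_expectation[OF s d])
    moreover have "integrable M (\<lambda>\<omega>. (X \<omega>)\<^sup>2)"
      using distributed_integrable[OF d, of "\<lambda>x. x\<^sup>2"] integrable_normal_moment[OF s, of 0 2] by simp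
    moreover have "expectation (\<lambda>\<omega>. (X \<omega>)\<^sup>2) = v / 2"
      using normal_distributed_variance[OF s d] e s2 by simp
    ultimately show ?thesis by blast
  qed
  note R = component[OF dR] and I = component[OF dI]
  have "integrable M (\<lambda>\<omega>. complex_of_real (Re (Z \<omega>)) + \<i> * complex_of_real (Im (Z \<omega>)))"
    using R I by (intro Bochner_Integration.integrable_add integrable_mult_right integrable_of_real) auto
  then show "integrable M Z" by (simp add: complex_eq[symmetric])
  show "expectation (\<lambda>\<omega>. Re (Z \<omega>)) = 0" "expectation (\<lambda>\<omega>. Im (Z \<omega>)) = 0"
    using R I by auto
  show "integrable M (\<lambda>\<omega>. (cmod (Z \<omega>))\<^sup>2)" "expectation (\<lambda>\<omega>. (cmod (Z \<omega>))\<^sup>2) = v"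
    using R I by (auto simp: cmod_power2)
qed

text \<open>The innovation \<open>z (1, 1)\<close> plays the role of the common reference variable \<open>z\<^sub>0\<close>.\<close>

definition fas_channel ::
  "real \<Rightarrow> real \<Rightarrow> (nat \<times> nat \<Rightarrow> 'a \<Rightarrow> complex) \<Rightarrow> nat \<times> nat \<Rightarrow> 'a \<Rightarrow> complex" where
  "fas_channel \<rho>1 \<rho>2 z = (\<lambda>(i, j) \<omega>.
     if i = 1 \<and> j = 1 then z (1, 1) \<omega>
     else if j = 1 then
       of_real (sqrt (1 - \<rho>1\<^sup>2)) * z (i, 1) \<omega> + of_real \<rho>1 * z (1, 1) \<omega>
     else if i = 1 then
       of_real (sqrt (1 - \<rho>2\<^sup>2)) * z (1, j) \<omega> + of_real \<rho>2 * z (1, 1) \<omega>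
     else
       of_real (sqrt (1 - \<rho>1\<^sup>2 * \<rho>2\<^sup>2)) * z (i, j) \<omega> + of_real (\<rho>1 * \<rho>2) * z (1, 1) \<omega>)"

definition fas_gain ::
  "nat \<Rightarrow> nat \<Rightarrow> (nat \<times> nat \<Rightarrow> 'a \<Rightarrow> complex) \<Rightarrow> 'a \<Rightarrow> real" where
  "fas_gain MR MT h \<omega> = Max ((\<lambda>p. cmod (h p \<omega>)) ` ({1..MR} \<times> {1..MT}))"

definition outage_prob ::
  "'a measure \<Rightarrow> nat \<Rightarrow> nat \<Rightarrow> (nat \<times> nat \<Rightarrow> 'a \<Rightarrow> complex) \<Rightarrow> real \<Rightarrow> real" where
  "outage_prob M MR MT h \<gamma> = measure M {\<omega> \<in> space M. (fas_gain MR MT h \<omega>)\<^sup>2 < \<gamma>}"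

end

theory Submission
  imports Defs
begin

text \<open>
  Conditioned on \<open>z (1, 1) = y\<close>, the channels are independent, and \<open>\<bar>h p\<bar>\<^sup>2 < \<gamma>\<close> says that a shifted
  standard Gaussian vector of the plane lands in a fixed disc about the origin (after rescaling). The probability of
  this depends only on the length of the shift, is \<open>1 - Q\<^sub>1\<close> of that length and the radius, and is
  decreasing in the length, because every horizontal slice of the disc is a centred interval, whose
  mass under a shifted one-dimensional Gaussian decreases with the shift. On the event
  \<open>\<bar>z (1, 1)\<bar>\<^sup>2 < \<gamma>\<close>, of probability \<open>1 - exp (- \<gamma>)\<close>, every factor is therefore at least its value at
  \<open>\<bar>y\<bar> = sqrt \<gamma>\<close>, and this is the claimed product.
\<close>

subsection \<open>Polar integration by radius and slope\<close>

text \<open>The origin is a null set and the negative half-line is reflected. Folding is needed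
  because a positive radius and a slope determine a point of the plane only up to sign.\<close>

lemma nn_integral_lborel_fold:
  fixes g :: "real \<Rightarrow> ennreal"
  assumes [measurable]: "g \<in> borel_measurable borel"
  shows "(\<integral>\<^sup>+x. g x \<partial>lborel) = (\<integral>\<^sup>+x\<in>{0<..}. (g x + g (- x)) \<partial>lborel)"
proof -
  have "(\<integral>\<^sup>+x. g x \<partial>lborel)
      = (\<integral>\<^sup>+x. g x * indicator {0<..} x + g x * indicator {..<0} x \<partial>lborel)"
    by (rule nn_integral_cong_AE, rule AE_mp[OF AE_lborel_singleton[of 0]])
       (auto split: split_indicator)
  also have "\<dots> = (\<integral>\<^sup>+x\<in>{0<..}. g x \<partial>lborel) + (\<integral>\<^sup>+x\<in>{..<0}. g x \<partial>lborel)"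
    by (rule nn_integral_add) auto
  also have "(\<integral>\<^sup>+x\<in>{..<0}. g x \<partial>lborel) = (\<integral>\<^sup>+x\<in>{0<..}. g (- x) \<partial>lborel)"
    by (subst nn_integral_real_affine[where c="-1" and t=0])
       (auto intro!: nn_integral_cong split: split_indicator)
  also have "(\<integral>\<^sup>+x\<in>{0<..}. g x \<partial>lborel) + \<dots> = (\<integral>\<^sup>+x\<in>{0<..}. (g x + g (- x)) \<partial>lborel)"
    by (subst nn_integral_add[symmetric]) (auto simp: distrib_right)
  finally show ?thesis .
qed

text \<open>
  Polar coordinates with the slope \<open>s = y / x\<close> in place of the angle: this needs affine substitutions
  and Fubini only.
\<close>

lemma nn_integral_plane_radius_slope:
  fixes f :: "real \<Rightarrow> real \<Rightarrow> ennreal"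
  assumes [measurable]: "case_prod f \<in> borel_measurable (borel \<Otimes>\<^sub>M borel)"
  defines "q \<equiv> \<lambda>s. sqrt (1 + s\<^sup>2)"
  shows "(\<integral>\<^sup>+x. \<integral>\<^sup>+y. f x y \<partial>lborel \<partial>lborel) =
    (\<integral>\<^sup>+r\<in>{0<..}. (\<integral>\<^sup>+s. ennreal (r / (1 + s\<^sup>2)) *
        (f (r / q s) (r * s / q s) + f (- (r / q s)) (- (r * s / q s))) \<partial>lborel) \<partial>lborel)"
proof -
  have q: "0 < q s" "1 + s\<^sup>2 = q s * q s" for s
    unfolding q_def by (auto simp: add_pos_nonneg abs_of_pos)
  have [measurable]: "q \<in> borel_measurable borel" unfolding q_def by measurable
  have "(\<integral>\<^sup>+x. \<integral>\<^sup>+y. f x y \<partial>lborel \<partial>lborel)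
      = (\<integral>\<^sup>+x\<in>{0<..}. ((\<integral>\<^sup>+y. f x y \<partial>lborel) + (\<integral>\<^sup>+y. f (- x) y \<partial>lborel)) \<partial>lborel)"
    by (rule nn_integral_lborel_fold) measurable
  also have "\<dots> = (\<integral>\<^sup>+x. (\<integral>\<^sup>+s. ennreal x * (f x (x * s) + f (- x) (- (x * s))) * indicator {0<..} x \<partial>lborel) \<partial>lborel)"
  proof (rule nn_integral_cong)
    fix x :: real
    show "((\<integral>\<^sup>+y. f x y \<partial>lborel) + (\<integral>\<^sup>+y. f (- x) y \<partial>lborel)) * indicator {0<..} x =
      (\<integral>\<^sup>+s. ennreal x * (f x (x * s) + f (- x) (- (x * s))) * indicator {0<..} x \<partial>lborel)"
    proof (cases "x > 0")
      case True
      \<comment> \<open>The substitution \<open>y = x * s\<close> has Jacobian \<open>x\<close>. In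
        the reflected half the scale is \<open>- x\<close>, with the same absolute value.\<close>
      have "(\<integral>\<^sup>+y. f x y \<partial>lborel) = ennreal x * (\<integral>\<^sup>+s. f x (x * s) \<partial>lborel)"
        using True by (subst nn_integral_real_affine[where c=x and t=0]) auto
      moreover have "(\<integral>\<^sup>+y. f (- x) y \<partial>lborel) = ennreal x * (\<integral>\<^sup>+s. f (- x) (- (x * s)) \<partial>lborel)"
        using True by (subst nn_integral_real_affine[where c="-x" and t=0]) auto
      ultimately show ?thesis
        using True by (simp add: nn_integral_cmult nn_integral_add distrib_left)
    qed auto
  qed
  \<comment> \<open>The slope becomes the outer variable, so that for fixed \<open>s\<close> the
    abscissa can be traded for the radius.\<close>
  also have "\<dots> = (\<integral>\<^sup>+s. (\<integral>\<^sup>+x. ennreal x * (f x (x * s) + f (- x) (- (x * s))) * indicator {0<..} x \<partial>lborel) \<partial>lborel)"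
    by (rule lborel_pair.Fubini') measurable
  also have "\<dots> = (\<integral>\<^sup>+s. (\<integral>\<^sup>+r. ennreal (r / (1 + s\<^sup>2)) *
      (f (r / q s) (r * s / q s) + f (- (r / q s)) (- (r * s / q s))) * indicator {0<..} r \<partial>lborel) \<partial>lborel)"
  proof (rule nn_integral_cong)
    fix s :: real
    \<comment> \<open>With \<open>x = r / q s\<close>, the factor \<open>x\<close> and the
      differential each contribute \<open>1 / q s\<close>; together they give the weight
      \<open>r / (1 + s\<^sup>2)\<close>.\<close>
    have "(\<integral>\<^sup>+x. ennreal x * (f x (x * s) + f (- x) (- (x * s))) * indicator {0<..} x \<partial>lborel)
      = ennreal (1 / q s) * (\<integral>\<^sup>+r. ennreal (r / q s) * (f (r / q s) (r * s / q s) + f (- (r / q s)) (- (r * s / q s))) * indicator {0<..} r \<partial>lborel)"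
      using q(1)[of s]
      by (subst nn_integral_real_affine[where c="1 / q s" and t=0])
         (auto intro!: nn_integral_cong arg_cong2[where f="(*)"] split: split_indicator simp: zero_less_divide_iff)
    also have "\<dots> = (\<integral>\<^sup>+r. ennreal (1 / q s) * (ennreal (r / q s) * (f (r / q s) (r * s / q s) + f (- (r / q s)) (- (r * s / q s))) * indicator {0<..} r) \<partial>lborel)"
      by (subst nn_integral_cmult) auto
    also have "\<dots> = (\<integral>\<^sup>+r. ennreal (r / (1 + s\<^sup>2)) *
      (f (r / q s) (r * s / q s) + f (- (r / q s)) (- (r * s / q s))) * indicator {0<..} r \<partial>lborel)"
    proof (rule nn_integral_cong)
      fix r :: real
      show "ennreal (1 / q s) * (ennreal (r / q s) * (f (r / q s) (r * s / q s) + f (- (r / q s)) (- (r * s / q s))) * indicator {0<..} r) = ennreal (r / (1 + s\<^sup>2)) *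
      (f (r / q s) (r * s / q s) + f (- (r / q s)) (- (r * s / q s))) * indicator {0<..} r"
        using q(1)[of s] by (cases "r > 0") (simp_all add: mult.assoc[symmetric] ennreal_mult[symmetric] q(2))
    qed
    finally show "(\<integral>\<^sup>+x. ennreal x * (f x (x * s) + f (- x) (- (x * s))) * indicator {0<..} x \<partial>lborel) =
      (\<integral>\<^sup>+r. ennreal (r / (1 + s\<^sup>2)) *
      (f (r / q s) (r * s / q s) + f (- (r / q s)) (- (r * s / q s))) * indicator {0<..} r \<partial>lborel)" .
  qed
  also have "\<dots> = (\<integral>\<^sup>+r. (\<integral>\<^sup>+s. ennreal (r / (1 + s\<^sup>2)) *
      (f (r / q s) (r * s / q s) + f (- (r / q s)) (- (r * s / q s))) * indicator {0<..} r \<partial>lborel) \<partial>lborel)"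
    by (rule lborel_pair.Fubini') measurable
  also have "\<dots> = (\<integral>\<^sup>+r\<in>{0<..}. (\<integral>\<^sup>+s. ennreal (r / (1 + s\<^sup>2)) *
      (f (r / q s) (r * s / q s) + f (- (r / q s)) (- (r * s / q s))) \<partial>lborel) \<partial>lborel)"
    by (subst nn_integral_multc) auto
  finally show ?thesis .
qed

text \<open>The value is the length of a half turn, the integrand being the derivative of the angle
  arctan s. It starts the induction on slope moments, and its multiples dominate the higher
  ones.\<close>

lemma has_bochner_integral_inverse_1_plus_square:
  "has_bochner_integral lborel (\<lambda>s::real. 1 / (1 + s\<^sup>2)) pi"
  using integrable_inverse_1_plus_square LBINT_inverse_1_plus_square
  by (simp add: has_bochner_integral_iff set_integrable_def interval_lebesgue_integral_def
      set_lebesgue_integral_def inverse_eq_divide)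

text \<open>
  In terms of the angle \<open>\<theta> = arctan s\<close>, the integral is that of \<open>(c1 cos \<theta> + c2 sin \<theta>) ^ (2 * k)\<close> over a
  half turn. With \<open>g = c1 cos \<theta> + c2 sin \<theta>\<close> the functions \<open>u\<close> and \<open>v\<close> of the proof are \<open>g\<^sup>2\<close> and \<open>g g'\<close>,
  and the induction step integrates the derivative of \<open>g ^ (2 * k + 1) * g'\<close>, which has period \<open>\<pi>\<close>.
\<close>

lemma has_bochner_integral_slope_moment:
  fixes c1 c2 :: real
  shows "has_bochner_integral lborel (\<lambda>s. ((c1 + c2 * s)\<^sup>2 / (1 + s\<^sup>2)) ^ k / (1 + s\<^sup>2))
    (pi * (c1\<^sup>2 + c2\<^sup>2) ^ k * fact (2 * k) / (4 ^ k * (fact k)\<^sup>2))"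
proof (induction k)
  case 0
  show ?case using has_bochner_integral_inverse_1_plus_square by simp
next
  case (Suc k)
  define c where "c = c1\<^sup>2 + c2\<^sup>2"
  define u where "u = (\<lambda>s. (c1 + c2 * s)\<^sup>2 / (1 + s\<^sup>2))"
  define v where "v = (\<lambda>s. (c1 + c2 * s) * (c2 - c1 * s) / (1 + s\<^sup>2))"
  define g where "g = (\<lambda>k s. u s ^ k / (1 + s\<^sup>2))"
  have pos: "0 < 1 + s\<^sup>2" "1 + s\<^sup>2 \<noteq> 0" for s :: real
    using zero_le_power2[of s] by linarith+
  have u_nonneg: "0 \<le> u s" for s
    unfolding u_def using pos[of s] by simp
  \<comment> \<open>In terms of the angle this is \<open>g\<^sup>2 + g'\<^sup>2 = c\<close>. It
    yields the bound \<open>u s \<le> c\<close> and the relation \<open>v2\<close>, which removes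
    \<open>v\<close> from the derivative below.\<close>
  have split: "(c1 + c2 * s)\<^sup>2 + (c2 - c1 * s)\<^sup>2 = c * (1 + s\<^sup>2)" for s
    unfolding c_def by (simp add: power2_eq_square algebra_simps)
  have u_diff: "c - u s = (c2 - c1 * s)\<^sup>2 / (1 + s\<^sup>2)" for s
    unfolding u_def using pos[of s] split[of s] by (simp add: field_simps)
  have u_le: "u s \<le> c" for s
  proof -
    have "0 \<le> c - u s" unfolding u_diff using pos[of s] by simp
    then show ?thesis by simp
  qed
  have v2: "v s * v s = u s * (c - u s)" for s
    unfolding u_diff unfolding u_def v_def by (simp add: power2_eq_square)
  have [measurable]: "u \<in> borel_measurable borel" unfolding u_def by measurable
  have int: "integrable lborel (g n)" for n
  proof (rule Bochner_Integration.integrable_bound)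
    show "integrable lborel (\<lambda>s. c ^ n * (1 / (1 + s\<^sup>2)))"
      using has_bochner_integral_inverse_1_plus_square
      by (intro integrable_mult_right) (auto simp: has_bochner_integral_iff)
    have "norm (g n s) \<le> norm (c ^ n * (1 / (1 + s\<^sup>2)))" for s
      unfolding g_def using pos[of s] u_nonneg[of s] u_le[of s] power_mono[OF u_le[of s] u_nonneg[of s], of n]
      by (simp add: divide_right_mono)
    then show "AE s in lborel. norm (g n s) \<le> norm (c ^ n * (1 / (1 + s\<^sup>2)))" by simp
  qed (simp add: g_def)
  have du: "(u has_real_derivative 2 * v s / (1 + s\<^sup>2)) (at s)" for s
    unfolding u_def v_def using pos[of s]
    by (auto intro!: derivative_eq_intros simp: field_simps) (simp add: power2_eq_square algebra_simps)
  have dv: "(v has_real_derivative (c - 2 * u s) / (1 + s\<^sup>2)) (at s)" for s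
    unfolding u_def v_def c_def using pos[of s]
    by (auto intro!: derivative_eq_intros simp: field_simps) (simp add: power2_eq_square algebra_simps)
  have deriv: "((\<lambda>s. u s ^ k * v s) has_real_derivative
      (2 * k + 1) * c * g k s - (2 * k + 2) * g (Suc k) s) (at s)" for s
  proof -
    have "((\<lambda>s. u s ^ k * v s) has_real_derivative
      (k * u s ^ (k - 1) * (2 * v s / (1 + s\<^sup>2))) * v s + (c - 2 * u s) / (1 + s\<^sup>2) * u s ^ k) (at s)"
      using DERIV_mult[OF DERIV_power[OF du[of s], of k] dv[of s]] by (simp add: mult_ac)
    moreover have "(k * u s ^ (k - 1) * (2 * v s / (1 + s\<^sup>2))) * v s = 2 * k * u s ^ k * (c - u s) / (1 + s\<^sup>2)"
    proof -
      have "(k * u s ^ (k - 1) * (2 * v s / (1 + s\<^sup>2))) * v s = 2 * k * u s ^ (k - 1) * (v s * v s) / (1 + s\<^sup>2)"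
        by simp
      also have "\<dots> = 2 * k * (u s ^ (k - 1) * u s) * (c - u s) / (1 + s\<^sup>2)"
        unfolding v2 by simp
      \<comment> \<open>At \<open>k = 0\<close> the exponent \<open>k - 1\<close> is truncated to
        \<open>0\<close>, but the factor \<open>k\<close> makes both sides vanish.\<close>
      also have "\<dots> = 2 * k * u s ^ k * (c - u s) / (1 + s\<^sup>2)"
        by (cases k) simp_all
      finally show ?thesis .
    qed
    moreover have "2 * k * u s ^ k * (c - u s) / (1 + s\<^sup>2) + (c - 2 * u s) / (1 + s\<^sup>2) * u s ^ k
        = (2 * k + 1) * c * g k s - (2 * k + 2) * g (Suc k) s"
      by (simp add: g_def add_divide_distrib diff_divide_distrib algebra_simps)
    ultimately show ?thesis by (simp only:)
  qed
  \<comment> \<open>Both ends of the line are the vertical direction, at angles differing by a half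
    turn. Since \<open>u\<close> and \<open>v\<close> are unchanged by a half turn, the two limits
    agree and the boundary terms cancel.\<close>
  have lim: "((\<lambda>s. u s ^ k * v s) \<longlongrightarrow> (c2\<^sup>2) ^ k * (- c1 * c2)) F" if F: "F = at_top \<or> F = at_bot" for F
  proof -
    have 1: "((\<lambda>s::real. 1 / (1 + s\<^sup>2)) \<longlongrightarrow> 0) F" "((\<lambda>s::real. s / (1 + s\<^sup>2)) \<longlongrightarrow> 0) F"
      using F by (safe; real_asymp)+
    have "((\<lambda>s. c1\<^sup>2 * (1 / (1 + s\<^sup>2)) + 2 * c1 * c2 * (s / (1 + s\<^sup>2)) + c2\<^sup>2 * (1 - 1 / (1 + s\<^sup>2)))
        \<longlongrightarrow> c1\<^sup>2 * 0 + 2 * c1 * c2 * 0 + c2\<^sup>2 * (1 - 0)) F"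
      by (intro tendsto_intros 1)
    moreover have "u = (\<lambda>s. c1\<^sup>2 * (1 / (1 + s\<^sup>2)) + 2 * c1 * c2 * (s / (1 + s\<^sup>2)) + c2\<^sup>2 * (1 - 1 / (1 + s\<^sup>2)))"
      unfolding u_def using pos(2) by (simp add: fun_eq_iff divide_simps) (simp add: power2_eq_square algebra_simps)
    ultimately have "(u \<longlongrightarrow> c2\<^sup>2) F" by simp
    moreover have "((\<lambda>s. c1 * c2 * (2 * (1 / (1 + s\<^sup>2)) - 1) + (c2\<^sup>2 - c1\<^sup>2) * (s / (1 + s\<^sup>2)))
        \<longlongrightarrow> c1 * c2 * (2 * 0 - 1) + (c2\<^sup>2 - c1\<^sup>2) * 0) F"
      by (intro tendsto_intros 1)
    moreover have "v = (\<lambda>s. c1 * c2 * (2 * (1 / (1 + s\<^sup>2)) - 1) + (c2\<^sup>2 - c1\<^sup>2) * (s / (1 + s\<^sup>2)))"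
      unfolding v_def using pos(2) by (simp add: fun_eq_iff divide_simps) (simp add: power2_eq_square algebra_simps)
    ultimately show ?thesis
      by (intro tendsto_intros) simp_all
  qed
  have "(LBINT s=-\<infinity>..\<infinity>. (2 * k + 1) * c * g k s - (2 * k + 2) * g (Suc k) s)
    = (c2\<^sup>2) ^ k * (- c1 * c2) - (c2\<^sup>2) ^ k * (- c1 * c2)"
  proof (rule interval_integral_FTC_integrable)
    show "((\<lambda>s. u s ^ k * v s) has_vector_derivative (2 * k + 1) * c * g k s - (2 * k + 2) * g (Suc k) s) (at s)" for s
      using deriv[of s] by (simp add: has_real_derivative_iff_has_vector_derivative)
    show "isCont (\<lambda>s. (2 * k + 1) * c * g k s - (2 * k + 2) * g (Suc k) s) s" for s
      unfolding g_def u_def using pos by (intro continuous_intros) auto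
    show "set_integrable lborel (einterval (-\<infinity>) \<infinity>) (\<lambda>s. (2 * k + 1) * c * g k s - (2 * k + 2) * g (Suc k) s)"
      unfolding set_integrable_def using int by auto
  qed (use lim in \<open>simp_all add: ereal_tendsto_simps\<close>)
  then have "(2 * k + 1) * c * integral\<^sup>L lborel (g k) = (2 * k + 2) * integral\<^sup>L lborel (g (Suc k))"
    using int by (simp add: interval_lebesgue_integral_def set_lebesgue_integral_def einterval_eq_UNIV)
  moreover have "integral\<^sup>L lborel (g k) = pi * c ^ k * fact (2 * k) / (4 ^ k * (fact k)\<^sup>2)"
    using Suc.IH by (simp add: has_bochner_integral_iff g_def u_def c_def)
  moreover have "(2 * k + 2) \<noteq> (0::real)" using of_nat_0_le_iff[of k] by linarith
  ultimately have "integral\<^sup>L lborel (g (Suc k)) = (2 * k + 1) * c * (pi * c ^ k * fact (2 * k) / (4 ^ k * (fact k)\<^sup>2)) / (2 * k + 2)"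
    by (simp add: nonzero_eq_divide_eq mult.commute)
  \<comment> \<open>\<open>(2 * k + 1) / (2 * k + 2)\<close> is the ratio of consecutive values of
    \<open>fact (2 * k) / (4 ^ k * (fact k)\<^sup>2)\<close>.\<close>
  also have "\<dots> = pi * c ^ Suc k * fact (2 * Suc k) / (4 ^ Suc k * (fact (Suc k))\<^sup>2)"
    by (simp add: divide_simps) (simp add: power2_eq_square algebra_simps)
  finally show ?case
    using int[of "Suc k"] by (simp add: has_bochner_integral_iff g_def u_def c_def)
qed

subsection \<open>Radial integrals of a shifted Gaussian\<close>

text \<open>The series in \<open>cosh_converges\<close> is zero at odd indices; reindexing along
  \<open>2 * k\<close> leaves a series in \<open>x\<^sup>2\<close>, whose terms match the slope
  moments.\<close>

lemma cosh_sums_even: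
  fixes x :: real
  shows "(\<lambda>k. (x\<^sup>2) ^ k / fact (2 * k)) sums cosh x"
proof -
  have "(\<lambda>k. if even (2 * k) then x ^ (2 * k) /\<^sub>R fact (2 * k) else 0) sums cosh x"
    using cosh_converges[of x]
    by (subst sums_mono_reindex[of "\<lambda>k. 2 * k"]) (auto simp: strict_mono_def)
  then show ?thesis by (simp add: power_mult divide_inverse mult.commute[of _ "inverse _"])
qed

text \<open>Convergence follows by comparison with the exponential series, since
  \<open>(fact k)\<^sup>2\<close> is at least \<open>fact k\<close>.\<close>

lemma bessel_I_0_sums: "(\<lambda>k. ((x / 2)\<^sup>2) ^ k / (fact k)\<^sup>2) sums bessel_I 0 x"
proof -
  have "summable (\<lambda>k. ((x / 2)\<^sup>2) ^ k / (fact k)\<^sup>2)"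
  proof (rule summable_comparison_test')
    show "summable (\<lambda>k. inverse (fact k) * ((x / 2)\<^sup>2) ^ k)"
      by (rule summable_exp)
    show "norm (((x / 2)\<^sup>2) ^ k / (fact k)\<^sup>2) \<le> inverse (fact k) * ((x / 2)\<^sup>2) ^ k" for k
    proof -
      define a where "a = ((x / 2)\<^sup>2) ^ k"
      have "0 \<le> a" unfolding a_def by simp
      moreover have "(1::real) \<le> fact k" by (rule fact_ge_1)
      ultimately have "a / (fact k)\<^sup>2 \<le> a / fact k"
        by (intro divide_left_mono self_le_power) auto
      with \<open>0 \<le> a\<close> show ?thesis unfolding a_def[symmetric] by (simp add: divide_inverse mult.commute)
    qed
  qed
  moreover have "bessel_I 0 x = (\<Sum>k. ((x / 2)\<^sup>2) ^ k / (fact k)\<^sup>2)"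
    unfolding bessel_I_def
    by (rule suminf_cong) (simp add: power_mult[of _ 2] power2_eq_square[of "fact k" for k])
  ultimately show ?thesis by (simp add: summable_sums)
qed

lemma bessel_I_0_nonneg: "0 \<le> bessel_I 0 x"
  using sums_unique[OF bessel_I_0_sums[of x]] sums_summable[OF bessel_I_0_sums[of x]]
  by (auto intro!: suminf_nonneg)

lemma bessel_I_0_0 [simp]: "bessel_I 0 0 = 1"
proof -
  have "(\<lambda>k. ((0 / 2 :: real)\<^sup>2) ^ k / (fact k)\<^sup>2) sums 1"
    using powser_sums_zero[of "\<lambda>k. 1 / (fact k)\<^sup>2 :: real"] by simp
  then show ?thesis by (rule sums_unique2[OF bessel_I_0_sums])
qed

lemma borel_measurable_bessel_I [measurable]: "bessel_I n \<in> borel_measurable borel"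
  unfolding bessel_I_def[abs_def] by measurable

text \<open>In the angle arctan s this is the classical representation of \<open>I\<^sub>0\<close>
  as an average of cosh over a half turn. The nonnegative terms of the cosh series may be integrated
  one by one, and the \<open>fact (2 * k)\<close> of each slope moment cancels the one in the
  series.\<close>

lemma nn_integral_cosh_slope:
  fixes c1 c2 r :: real
  shows "(\<integral>\<^sup>+s. ennreal (cosh (r * ((c1 + c2 * s) / sqrt (1 + s\<^sup>2))) / (1 + s\<^sup>2)) \<partial>lborel)
    = ennreal (pi * bessel_I 0 (sqrt (c1\<^sup>2 + c2\<^sup>2) * r))"
proof -
  define W where "W = (\<lambda>k s. ((c1 + c2 * s)\<^sup>2 / (1 + s\<^sup>2)) ^ k / (1 + s\<^sup>2))"
  have W_nonneg: "0 \<le> W k s" for k s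
    unfolding W_def by simp
  have "(\<lambda>k. (r\<^sup>2) ^ k / fact (2 * k) * W k s) sums (cosh (r * ((c1 + c2 * s) / sqrt (1 + s\<^sup>2))) / (1 + s\<^sup>2))" for s
    using sums_divide[OF cosh_sums_even[of "r * ((c1 + c2 * s) / sqrt (1 + s\<^sup>2))"], of "1 + s\<^sup>2"]
    by (simp add: W_def power_mult_distrib power_divide mult_ac)
  then have "(\<Sum>k. ennreal ((r\<^sup>2) ^ k / fact (2 * k) * W k s))
      = ennreal (cosh (r * ((c1 + c2 * s) / sqrt (1 + s\<^sup>2))) / (1 + s\<^sup>2))" for s
    using W_nonneg by (intro suminf_ennreal_eq mult_nonneg_nonneg) auto
  then have "(\<integral>\<^sup>+s. ennreal (cosh (r * ((c1 + c2 * s) / sqrt (1 + s\<^sup>2))) / (1 + s\<^sup>2)) \<partial>lborel)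
      = (\<integral>\<^sup>+s. (\<Sum>k. ennreal ((r\<^sup>2) ^ k / fact (2 * k) * W k s)) \<partial>lborel)"
    by simp
  also have "\<dots> = (\<Sum>k. \<integral>\<^sup>+s. ennreal ((r\<^sup>2) ^ k / fact (2 * k) * W k s) \<partial>lborel)"
    by (rule nn_integral_suminf) (simp add: W_def)
  also have "\<dots> = (\<Sum>k. ennreal (pi * ((((sqrt (c1\<^sup>2 + c2\<^sup>2) * r) / 2)\<^sup>2) ^ k / (fact k)\<^sup>2)))"
  proof (rule suminf_cong)
    fix k
    have "has_bochner_integral lborel (\<lambda>s. (r\<^sup>2) ^ k / fact (2 * k) * W k s)
      ((r\<^sup>2) ^ k / fact (2 * k) * (pi * (c1\<^sup>2 + c2\<^sup>2) ^ k * fact (2 * k) / (4 ^ k * (fact k)\<^sup>2)))"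
      unfolding W_def by (intro has_bochner_integral_mult_right has_bochner_integral_slope_moment)
    moreover have "(r\<^sup>2) ^ k / fact (2 * k) * (pi * (c1\<^sup>2 + c2\<^sup>2) ^ k * fact (2 * k) / (4 ^ k * (fact k)\<^sup>2))
        = pi * ((((sqrt (c1\<^sup>2 + c2\<^sup>2) * r) / 2)\<^sup>2) ^ k / (fact k)\<^sup>2)"
      by (simp add: power_mult_distrib power_divide)
    ultimately show "(\<integral>\<^sup>+s. ennreal ((r\<^sup>2) ^ k / fact (2 * k) * W k s) \<partial>lborel)
        = ennreal (pi * ((((sqrt (c1\<^sup>2 + c2\<^sup>2) * r) / 2)\<^sup>2) ^ k / (fact k)\<^sup>2))"
      using W_nonneg by (subst nn_integral_eq_integral) (auto simp: has_bochner_integral_iff)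
  qed
  also have "\<dots> = ennreal (pi * bessel_I 0 (sqrt (c1\<^sup>2 + c2\<^sup>2) * r))"
    by (intro suminf_ennreal_eq sums_mult bessel_I_0_sums) simp
  finally show ?thesis .
qed

text \<open>The density of the modulus of a planar Gaussian vector with unit variance in each
  coordinate and mean at distance \<open>c\<close> from the origin; it is also the integrand of
  \<open>marcum_Q1 c\<close>.\<close>

definition rice_density :: "real \<Rightarrow> real \<Rightarrow> real" where
  "rice_density c r = r * exp (- ((r\<^sup>2 + c\<^sup>2) / 2)) * bessel_I 0 (c * r)"

lemma rice_density_nonneg: "0 \<le> r \<Longrightarrow> 0 \<le> rice_density c r"
  by (simp add: rice_density_def bessel_I_0_nonneg)

lemma borel_measurable_rice_density [measurable]: "rice_density c \<in> borel_measurable borel"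
  unfolding rice_density_def by measurable

lemma std_normal_density_prod:
  "std_normal_density x * std_normal_density y = exp (- ((x\<^sup>2 + y\<^sup>2) / 2)) / (2 * pi)"
  by (simp add: normal_density_def exp_add[symmetric] field_simps)

text \<open>On a circle about the origin the Gaussian weight varies only through the exponential of
  the inner product with the shift. Opposite points combine to a cosh, whose slope integral is the
  Bessel factor and depends on the shift through its length alone.\<close>

lemma nn_integral_shifted_std_normal_radial:
  fixes h :: "real \<Rightarrow> ennreal"
  assumes [measurable]: "h \<in> borel_measurable borel"
  shows "(\<integral>\<^sup>+x. \<integral>\<^sup>+y. ennreal (std_normal_density (x - c1) * std_normal_density (y - c2)) * h (x\<^sup>2 + y\<^sup>2)
      \<partial>lborel \<partial>lborel)
    = (\<integral>\<^sup>+r\<in>{0<..}. ennreal (rice_density (sqrt (c1\<^sup>2 + c2\<^sup>2)) r) * h (r\<^sup>2) \<partial>lborel)"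
    (is "?L = ?R")
proof -
  define c where "c = sqrt (c1\<^sup>2 + c2\<^sup>2)"
  define q where "q = (\<lambda>s::real. sqrt (1 + s\<^sup>2))"
  define f where "f = (\<lambda>x y. ennreal (std_normal_density (x - c1) * std_normal_density (y - c2)) * h (x\<^sup>2 + y\<^sup>2))"
  have q: "0 < q s" "(q s)\<^sup>2 = 1 + s\<^sup>2" for s
    unfolding q_def by (auto simp: add_pos_nonneg)
  have c2: "c\<^sup>2 = c1\<^sup>2 + c2\<^sup>2" unfolding c_def by simp
  have [measurable]: "(cosh :: real \<Rightarrow> real) \<in> borel_measurable borel"
    by (intro borel_measurable_continuous_onI continuous_intros)
  have inner: "ennreal (r / (1 + s\<^sup>2)) * (f (r / q s) (r * s / q s) + f (- (r / q s)) (- (r * s / q s)))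
      = ennreal (r * exp (- ((r\<^sup>2 + c\<^sup>2) / 2)) / pi) * h (r\<^sup>2) * ennreal (cosh (r * ((c1 + c2 * s) / q s)) / (1 + s\<^sup>2))"
    if "0 < r" for r s
  proof -
    \<comment> \<open>\<open>t\<close> is the inner product of the shift with the point of radius
      \<open>r\<close> and slope \<open>s\<close>. The opposite point has \<open>- t\<close>, so the
      two exponentials add up to \<open>2 * cosh t\<close>.\<close>
    define t where "t = r * ((c1 + c2 * s) / q s)"
    have rad: "(r / q s)\<^sup>2 + (r * s / q s)\<^sup>2 = r\<^sup>2"
    proof -
      have "(r / q s)\<^sup>2 + (r * s / q s)\<^sup>2 = r\<^sup>2 * (1 + s\<^sup>2) / (q s)\<^sup>2"
        by (simp add: power_divide power_mult_distrib add_divide_distrib[symmetric] distrib_left)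
      then show ?thesis using q(1)[of s] unfolding q(2)[symmetric] by simp
    qed
    have lin: "c1 * (r / q s) + c2 * (r * s / q s) = t"
      unfolding t_def by (simp add: add_divide_distrib distrib_left mult_ac)
    have cosh_scale: "a / (2 * pi) * exp t + a / (2 * pi) * exp (- t) = a / pi * cosh t" for a
      by (simp add: cosh_field_def distrib_left distrib_right add_divide_distrib)
    have exp_split: "exp (- ((a - 2 * t) / 2)) = exp (- (a / 2)) * exp t" for a t :: real
      by (simp add: exp_add[symmetric] diff_divide_distrib)
    have sq: "(x - c1)\<^sup>2 + (y - c2)\<^sup>2 = (x\<^sup>2 + y\<^sup>2) + c\<^sup>2 - 2 * (c1 * x + c2 * y)" for x y
      unfolding c2 by (simp add: power2_eq_square algebra_simps)
    have d1: "std_normal_density (r / q s - c1) * std_normal_density (r * s / q s - c2)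
        = exp (- ((r\<^sup>2 + c\<^sup>2) / 2)) / (2 * pi) * exp t"
      unfolding std_normal_density_prod sq rad lin exp_split by simp
    have lin': "c1 * (- (r / q s)) + c2 * (- (r * s / q s)) = - t"
      using lin by linarith
    have d2: "std_normal_density (- (r / q s) - c1) * std_normal_density (- (r * s / q s) - c2)
        = exp (- ((r\<^sup>2 + c\<^sup>2) / 2)) / (2 * pi) * exp (- t)"
      unfolding std_normal_density_prod sq power2_minus rad lin' exp_split by simp
    have "f (r / q s) (r * s / q s) + f (- (r / q s)) (- (r * s / q s))
        = ennreal (exp (- ((r\<^sup>2 + c\<^sup>2) / 2)) / (2 * pi) * exp t + exp (- ((r\<^sup>2 + c\<^sup>2) / 2)) / (2 * pi) * exp (- t)) * h (r\<^sup>2)"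
      unfolding f_def d1 d2 power2_minus rad by (subst ennreal_plus) (auto simp: distrib_right)
    also have "exp (- ((r\<^sup>2 + c\<^sup>2) / 2)) / (2 * pi) * exp t + exp (- ((r\<^sup>2 + c\<^sup>2) / 2)) / (2 * pi) * exp (- t)
        = exp (- ((r\<^sup>2 + c\<^sup>2) / 2)) / pi * cosh t"
      by (rule cosh_scale)
    finally have *: "f (r / q s) (r * s / q s) + f (- (r / q s)) (- (r * s / q s))
        = ennreal (exp (- ((r\<^sup>2 + c\<^sup>2) / 2)) / pi * cosh t) * h (r\<^sup>2)" .
    have "ennreal (r / (1 + s\<^sup>2)) * ennreal (exp (- ((r\<^sup>2 + c\<^sup>2) / 2)) / pi * cosh t)
      = ennreal (r * exp (- ((r\<^sup>2 + c\<^sup>2) / 2)) / pi) * ennreal (cosh t / (1 + s\<^sup>2))"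
      using that by (subst (1 2) ennreal_mult[symmetric]) (auto simp: mult_ac)
    then have "ennreal (r / (1 + s\<^sup>2)) * (ennreal (exp (- ((r\<^sup>2 + c\<^sup>2) / 2)) / pi * cosh t) * h (r\<^sup>2))
      = ennreal (r * exp (- ((r\<^sup>2 + c\<^sup>2) / 2)) / pi) * ennreal (cosh t / (1 + s\<^sup>2)) * h (r\<^sup>2)"
      by (simp only: mult.assoc[symmetric])
    then show ?thesis unfolding * t_def[symmetric] by (simp only: mult_ac)
  qed
  have "?L = (\<integral>\<^sup>+r\<in>{0<..}. (\<integral>\<^sup>+s. ennreal (r / (1 + s\<^sup>2)) *
        (f (r / q s) (r * s / q s) + f (- (r / q s)) (- (r * s / q s))) \<partial>lborel) \<partial>lborel)"
    unfolding q_def f_def by (rule nn_integral_plane_radius_slope) measurable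
  also have "\<dots> = (\<integral>\<^sup>+r\<in>{0<..}. ennreal (rice_density c r) * h (r\<^sup>2) \<partial>lborel)"
  proof (rule nn_integral_cong)
    fix r :: real
    show "(\<integral>\<^sup>+s. ennreal (r / (1 + s\<^sup>2)) *
        (f (r / q s) (r * s / q s) + f (- (r / q s)) (- (r * s / q s))) \<partial>lborel) * indicator {0<..} r
      = ennreal (rice_density c r) * h (r\<^sup>2) * indicator {0<..} r"
    proof (cases "0 < r")
      case True
      have "(\<integral>\<^sup>+s. ennreal (r / (1 + s\<^sup>2)) *
        (f (r / q s) (r * s / q s) + f (- (r / q s)) (- (r * s / q s))) \<partial>lborel)
        = ennreal (r * exp (- ((r\<^sup>2 + c\<^sup>2) / 2)) / pi) * h (r\<^sup>2) * ennreal (pi * bessel_I 0 (c * r))"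
        unfolding inner[OF True] unfolding q_def c_def nn_integral_cosh_slope[symmetric]
        by (rule nn_integral_cmult) measurable
      also have "\<dots> = ennreal (r * exp (- ((r\<^sup>2 + c\<^sup>2) / 2)) / pi * (pi * bessel_I 0 (c * r))) * h (r\<^sup>2)"
        using True by (subst ennreal_mult) (auto simp: bessel_I_0_nonneg mult_ac)
      finally show ?thesis by (simp add: rice_density_def mult.assoc)
    qed auto
  qed
  finally show ?thesis unfolding c_def .
qed

subsection \<open>The Rice distribution and the Marcum function\<close>

text \<open>Kept as an \<open>ennreal\<close> integral, so that splitting and comparing masses needs
  no integrability proofs.\<close>

definition rice_cdf :: "real \<Rightarrow> real \<Rightarrow> ennreal" where
  "rice_cdf c R = (\<integral>\<^sup>+r\<in>{0<..<R}. ennreal (rice_density c r) \<partial>lborel)"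

text \<open>The radial formula with \<open>h\<close> constantly 1 and shift \<open>(c, 0)\<close>
  turns the mass into a product of two one-dimensional Gaussian masses.\<close>

lemma nn_integral_rice_density:
  assumes "0 \<le> c"
  shows "(\<integral>\<^sup>+r\<in>{0<..}. ennreal (rice_density c r) \<partial>lborel) = 1"
proof -
  have std: "(\<integral>\<^sup>+x. ennreal (std_normal_density (x - m)) \<partial>lborel) = 1" for m
    using prob_space.emeasure_space_1[OF prob_space_normal_density[of 1 m]]
    by (simp add: emeasure_density normal_density_def)
  have "(\<integral>\<^sup>+r\<in>{0<..}. ennreal (rice_density c r) \<partial>lborel)
      = (\<integral>\<^sup>+x. \<integral>\<^sup>+y. ennreal (std_normal_density (x - c) * std_normal_density (y - 0)) \<partial>lborel \<partial>lborel)"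
    using nn_integral_shifted_std_normal_radial[of "\<lambda>_. 1" c 0] assms by simp
  also have "\<dots> = (\<integral>\<^sup>+x. ennreal (std_normal_density (x - c)) * (\<integral>\<^sup>+y. ennreal (std_normal_density (y - 0)) \<partial>lborel) \<partial>lborel)"
    by (intro nn_integral_cong) (simp add: nn_integral_cmult[symmetric] ennreal_mult)
  also have "\<dots> = 1"
    unfolding std by (simp add: std)
  finally show ?thesis .
qed

text \<open>\<open>marcum_Q1 a b\<close> is the mass of the Rice density beyond \<open>b\<close>,
  and the total mass is 1.\<close>

lemma rice_cdf_eq_marcum_Q1:
  assumes "0 \<le> a" "0 < b"
  shows "rice_cdf a b = ennreal (1 - marcum_Q1 a b)" and "marcum_Q1 a b \<le> 1"
proof -
  define T where "T = (\<integral>\<^sup>+r\<in>{b..}. ennreal (rice_density a r) \<partial>lborel)"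
  have "rice_cdf a b + T = (\<integral>\<^sup>+r\<in>{0<..}. ennreal (rice_density a r) \<partial>lborel)"
    unfolding T_def rice_cdf_def using assms(2)
    by (subst nn_integral_add[symmetric]) (auto intro!: nn_integral_cong split: split_indicator)
  then have sum: "rice_cdf a b + T = 1"
    using nn_integral_rice_density[OF assms(1)] by simp
  then have T1: "T \<le> 1" unfolding sum[symmetric] by simp
  have "marcum_Q1 a b = (\<integral>r. indicator {b..} r * rice_density a r \<partial>lborel)"
    unfolding marcum_Q1_def rice_density_def set_lebesgue_integral_def by simp
  \<comment> \<open>Positivity of \<open>b\<close> keeps the tail inside the half-line where the
    density is known to be nonnegative.\<close>
  also have "\<dots> = enn2real (\<integral>\<^sup>+r. ennreal (indicator {b..} r * rice_density a r) \<partial>lborel)"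
    using assms(2) by (intro integral_eq_nn_integral) (auto simp: rice_density_nonneg split: split_indicator)
  also have "(\<integral>\<^sup>+r. ennreal (indicator {b..} r * rice_density a r) \<partial>lborel) = T"
    unfolding T_def by (intro nn_integral_cong) (auto split: split_indicator)
  finally have Q: "marcum_Q1 a b = enn2real T" .
  with T1 show "marcum_Q1 a b \<le> 1" by (simp add: enn2real_leI)
  \<comment> \<open>\<open>enn2real\<close> sends infinity to 0, so finiteness of \<open>T\<close>
    is required here.\<close>
  have "ennreal (marcum_Q1 a b) = T"
    unfolding Q using T1 by (intro ennreal_enn2real) (auto simp: less_top[symmetric] top_unique)
  then have "ennreal (1 - marcum_Q1 a b) = 1 - T"
    using ennreal_minus[of "marcum_Q1 a b" 1] by (simp add: Q)
  also have "\<dots> = rice_cdf a b"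
    unfolding sum[symmetric] using T1 by (intro ennreal_add_diff_cancel_right) (auto simp: top_unique)
  finally show "rice_cdf a b = ennreal (1 - marcum_Q1 a b)" ..
qed

text \<open>Without a shift the Bessel factor is 1 and the density is that of the Rayleigh law, with
  antiderivative \<open>- exp (- (r\<^sup>2 / 2))\<close>.\<close>

lemma rice_cdf_0:
  assumes "0 < R"
  shows "rice_cdf 0 R = ennreal (1 - exp (- (R\<^sup>2 / 2)))"
proof -
  have "rice_cdf 0 R = (\<integral>\<^sup>+r. ennreal (r * exp (- (r\<^sup>2 / 2))) * indicator {0..R} r \<partial>lborel)"
    unfolding rice_cdf_def
    by (rule nn_integral_cong_AE, rule AE_mp[OF AE_lborel_singleton[of 0]], rule AE_mp[OF AE_lborel_singleton[of R]])
       (auto simp: rice_density_def split: split_indicator)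
  also have "\<dots> = ennreal (- exp (- (R\<^sup>2 / 2)) - - exp (- (0\<^sup>2 / 2)))"
    using assms
    by (intro nn_integral_FTC_Icc[where F="\<lambda>r. - exp (- (r\<^sup>2 / 2))"])
       (auto intro!: derivative_eq_intros)
  finally show ?thesis by simp
qed

text \<open>For \<open>t > 0\<close> and \<open>r = sqrt t\<close>, the mass has derivative
  \<open>std_normal_density (- r - x) - std_normal_density (r - x)\<close> in the shift
  \<open>x\<close>. This is nonpositive for \<open>0 \<le> x\<close>, where \<open>r - x\<close> is
  no farther from 0 than \<open>- r - x\<close>.\<close>

lemma nn_integral_std_normal_interval_antimono:
  assumes "0 \<le> c" "c \<le> d"
  shows "(\<integral>\<^sup>+x. ennreal (std_normal_density (x - d)) * indicator {..<t} (x\<^sup>2) \<partial>lborel)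
    \<le> (\<integral>\<^sup>+x. ennreal (std_normal_density (x - c)) * indicator {..<t} (x\<^sup>2) \<partial>lborel)"
proof (cases "0 < t")
  \<comment> \<open>The interval is empty; this occurs for slices of the disc at heights
    \<open>y\<close> with \<open>R\<^sup>2 \<le> y\<^sup>2\<close>.\<close>
  case False
  have "\<not> x\<^sup>2 < t" for x :: real
    using zero_le_power2[of x] False by linarith
  then have "indicator {..<t} (x\<^sup>2) = (0 :: ennreal)" for x :: real
    by (simp add: indicator_def)
  then show ?thesis by simp
next
  case True
  define r where "r = sqrt t"
  have r: "0 < r" using True unfolding r_def by simp
  have "\<exists>F. \<forall>x. - \<infinity> < ereal x \<longrightarrow> ereal x < \<infinity> \<longrightarrow> (F has_vector_derivative std_normal_density x) (at x)"
    by (rule einterval_antiderivative) (auto simp: normal_density_def intro!: continuous_intros)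
  then obtain F where F: "(F has_real_derivative std_normal_density x) (at x)" for x
    by (auto simp: has_real_derivative_iff_has_vector_derivative)
  have eq: "(\<integral>\<^sup>+x. ennreal (std_normal_density (x - c)) * indicator {..<t} (x\<^sup>2) \<partial>lborel)
      = ennreal (F (r - c) - F (- r - c))" for c
  proof -
    \<comment> \<open>The endpoints form a null set, so the interval may be closed for the
      fundamental theorem of calculus.\<close>
    have "(\<integral>\<^sup>+x. ennreal (std_normal_density (x - c)) * indicator {..<t} (x\<^sup>2) \<partial>lborel)
      = (\<integral>\<^sup>+x. ennreal (std_normal_density (x - c)) * indicator {-r..r} x \<partial>lborel)"
    proof (rule nn_integral_cong_AE, rule AE_mp[OF AE_lborel_singleton[of r]], rule AE_mp[OF AE_lborel_singleton[of "-r"]],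
        intro AE_I2 impI)
      fix x assume "x \<noteq> - r" "x \<noteq> r"
      then have "x\<^sup>2 < t \<longleftrightarrow> - r \<le> x \<and> x \<le> r"
        using real_sqrt_less_iff[of "x\<^sup>2" t] unfolding r_def[symmetric] real_sqrt_abs by linarith
      then show "ennreal (std_normal_density (x - c)) * indicator {..<t} (x\<^sup>2)
          = ennreal (std_normal_density (x - c)) * indicator {-r..r} x"
        by (simp add: indicator_def)
    qed
    also have "\<dots> = ennreal (F (r - c) - F (- r - c))"
      using r
      by (intro nn_integral_FTC_Icc[where F="\<lambda>x. F (x - c)"]
            DERIV_cong[OF DERIV_chain2[OF F DERIV_diff[OF DERIV_ident DERIV_const]]]) auto
    finally show ?thesis .
  qed
  have "F (r - d) - F (- r - d) \<le> F (r - c) - F (- r - c)"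
  proof (rule DERIV_nonpos_imp_nonincreasing[OF assms(2)])
    fix x assume x: "c \<le> x" "x \<le> d"
    have "((\<lambda>x. F (r - x) - F (- r - x)) has_real_derivative
        (std_normal_density (r - x) * (0 - 1) - std_normal_density (- r - x) * (0 - 1))) (at x)"
      by (intro DERIV_diff DERIV_chain2[OF F] DERIV_const DERIV_ident)
    moreover have "(r - x)\<^sup>2 \<le> (- r - x)\<^sup>2"
      using r assms(1) x(1) by (simp add: power2_eq_square algebra_simps)
    then have "std_normal_density (- r - x) \<le> std_normal_density (r - x)"
      by (simp add: normal_density_def divide_right_mono)
    ultimately show "\<exists>y. ((\<lambda>x. F (r - x) - F (- r - x)) has_real_derivative y) (at x) \<and> y \<le> 0"
      by (intro exI conjI) (assumption, simp)
  qed
  then show ?thesis unfolding eq by (rule ennreal_leI)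
qed

text \<open>Since only the length of the shift survives, the shift may be rotated onto a coordinate
  axis when masses of discs are compared.\<close>

lemma nn_integral_shifted_std_normal_disc:
  assumes "0 < R"
  shows "(\<integral>\<^sup>+x. \<integral>\<^sup>+y. ennreal (std_normal_density (x - c1) * std_normal_density (y - c2)) * indicator {..<R\<^sup>2} (x\<^sup>2 + y\<^sup>2)
      \<partial>lborel \<partial>lborel) = rice_cdf (sqrt (c1\<^sup>2 + c2\<^sup>2)) R"
proof -
  have *: "indicator {..<R\<^sup>2} (r\<^sup>2) * indicator {0<..} r = (indicator {0<..<R} r :: ennreal)" for r
    using assms power_mono_iff[of R r 2] by (cases "0 < r") (simp_all add: indicator_def not_le[symmetric])
  show ?thesis
    unfolding rice_cdf_def *[symmetric]
    by (subst nn_integral_shifted_std_normal_radial) (simp_all only: mult.assoc borel_measurable_indicator lessThan_borel)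
qed

text \<open>With the shift placed on the first axis, the weight in \<open>y\<close> is free of it,
  and each horizontal slice is a centred interval to which the one-dimensional comparison
  applies.\<close>

lemma rice_cdf_antimono:
  assumes "0 \<le> c" "c \<le> d" "0 < R"
  shows "rice_cdf d R \<le> rice_cdf c R"
proof -
  have slices: "rice_cdf a R = (\<integral>\<^sup>+y. ennreal (std_normal_density y) *
      (\<integral>\<^sup>+x. ennreal (std_normal_density (x - a)) * indicator {..<R\<^sup>2 - y\<^sup>2} (x\<^sup>2) \<partial>lborel) \<partial>lborel)" if "0 \<le> a" for a
  proof -
    have "rice_cdf a R = (\<integral>\<^sup>+x. \<integral>\<^sup>+y. ennreal (std_normal_density (x - a) * std_normal_density (y - 0)) * indicator {..<R\<^sup>2} (x\<^sup>2 + y\<^sup>2)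
      \<partial>lborel \<partial>lborel)"
      using that nn_integral_shifted_std_normal_disc[OF assms(3), of a 0] by simp
    \<comment> \<open>The order is exchanged so that the inner integral runs along the direction of
      the shift.\<close>
    also have "\<dots> = (\<integral>\<^sup>+y. \<integral>\<^sup>+x. ennreal (std_normal_density (x - a) * std_normal_density (y - 0)) * indicator {..<R\<^sup>2} (x\<^sup>2 + y\<^sup>2)
      \<partial>lborel \<partial>lborel)"
      by (rule lborel_pair.Fubini') measurable
    also have "\<dots> = (\<integral>\<^sup>+y. ennreal (std_normal_density y) *
      (\<integral>\<^sup>+x. ennreal (std_normal_density (x - a)) * indicator {..<R\<^sup>2 - y\<^sup>2} (x\<^sup>2) \<partial>lborel) \<partial>lborel)"
    proof (rule nn_integral_cong)
      fix y :: real
      have "(\<integral>\<^sup>+x. ennreal (std_normal_density (x - a) * std_normal_density (y - 0)) * indicator {..<R\<^sup>2} (x\<^sup>2 + y\<^sup>2) \<partial>lborel)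
        = (\<integral>\<^sup>+x. ennreal (std_normal_density y) * (ennreal (std_normal_density (x - a)) * indicator {..<R\<^sup>2 - y\<^sup>2} (x\<^sup>2)) \<partial>lborel)"
        by (intro nn_integral_cong) (auto simp: ennreal_mult mult_ac split: split_indicator)
      then show "(\<integral>\<^sup>+x. ennreal (std_normal_density (x - a) * std_normal_density (y - 0)) * indicator {..<R\<^sup>2} (x\<^sup>2 + y\<^sup>2) \<partial>lborel)
        = ennreal (std_normal_density y) * (\<integral>\<^sup>+x. ennreal (std_normal_density (x - a)) * indicator {..<R\<^sup>2 - y\<^sup>2} (x\<^sup>2) \<partial>lborel)"
        by (simp add: nn_integral_cmult)
    qed
    finally show ?thesis .
  qed
  show ?thesis
    using assms by (simp add: slices) (intro nn_integral_mono mult_left_mono nn_integral_std_normal_interval_antimono; simp)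
qed

subsection \<open>Gaussian discs and conditioning\<close>

text \<open>Each component of \<open>Z\<close> has variance \<open>1 / 2\<close>. Scaling
  \<open>s * Z + w\<close> by \<open>sqrt 2 / s\<close> gives a standard planar Gaussian with mean
  \<open>sqrt 2 * w / s\<close>, and the disc of radius \<open>sqrt \<gamma>\<close> becomes one of
  radius \<open>sqrt (2 * \<gamma>) / s\<close>.\<close>

lemma (in prob_space) emeasure_circ_sym_complex_gaussian_disc:
  fixes w :: complex
  assumes Z: "circ_sym_complex_gaussian M 1 Z" and s: "0 < s" and \<gamma>: "0 < \<gamma>"
  shows "emeasure M {\<omega> \<in> space M. (cmod (of_real s * Z \<omega> + w))\<^sup>2 < \<gamma>}
    = rice_cdf (sqrt 2 * cmod w / s) (sqrt (2 * \<gamma>) / s)"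
proof -
  define n where "n = normal_density 0 (sqrt (1 / 2))"
  define c1 c2 where "c1 = sqrt 2 * Re w / s" and "c2 = sqrt 2 * Im w / s"
  define A where "A = {(x, y). (s * x + Re w)\<^sup>2 + (s * y + Im w)\<^sup>2 < \<gamma>}"
  have [measurable]: "n \<in> borel_measurable borel" unfolding n_def by measurable
  have n_nonneg: "0 \<le> n x" for x unfolding n_def by simp
  have A: "A \<in> sets (lborel \<Otimes>\<^sub>M lborel)"
  proof -
    have "(\<lambda>p. (s * fst p + Re w)\<^sup>2 + (s * snd p + Im w)\<^sup>2) \<in> borel_measurable (lborel \<Otimes>\<^sub>M lborel)"
      by measurable
    from borel_measurable_iff_less[THEN iffD1, OF this, rule_format, of \<gamma>] show ?thesis
      by (simp add: A_def space_pair_measure case_prod_beta')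
  qed
  have D: "distributed M (lborel \<Otimes>\<^sub>M lborel) (\<lambda>\<omega>. (Re (Z \<omega>), Im (Z \<omega>))) (\<lambda>(x, y). ennreal (n x) * ennreal (n y))"
  proof (rule distributed_joint_indep')
    \<comment> \<open>Independence is stated over \<open>borel\<close> and the densities over
      \<open>lborel\<close>; the two have the same measurable sets.\<close>
    have "distr M borel X = distr M lborel X" for X :: "'a \<Rightarrow> real"
      by (rule distr_cong) simp_all
    moreover have "distr M (borel \<Otimes>\<^sub>M borel) X = distr M (lborel \<Otimes>\<^sub>M lborel) X" for X :: "'a \<Rightarrow> real \<times> real"
      by (rule distr_cong[OF refl sets_pair_measure_cong[OF sets_lborel[symmetric] sets_lborel[symmetric]] refl])
    ultimately show "distr M lborel (\<lambda>\<omega>. Re (Z \<omega>)) \<Otimes>\<^sub>M distr M lborel (\<lambda>\<omega>. Im (Z \<omega>))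
        = distr M (lborel \<Otimes>\<^sub>M lborel) (\<lambda>\<omega>. (Re (Z \<omega>), Im (Z \<omega>)))"
      using Z unfolding circ_sym_complex_gaussian_def indep_var_distribution_eq by metis
  qed (use Z in \<open>simp_all add: circ_sym_complex_gaussian_def n_def lborel.sigma_finite_measure_axioms\<close>)
  \<comment> \<open>The Jacobian \<open>1 / sqrt 2\<close> of the substitution turns the density of
    variance \<open>1 / 2\<close> into a shifted standard one.\<close>
  have n_shift: "n ((x - c) / sqrt 2) / sqrt 2 = std_normal_density (x - c)" for x c
    unfolding n_def normal_density_def by (simp add: power_divide real_sqrt_mult)
  \<comment> \<open>The constants \<open>c1\<close> and \<open>c2\<close> are chosen so that the
    substitution cancels \<open>w\<close> here: the disc becomes centred and the shift moves into
    the density.\<close>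
  have dom: "(s * ((x - c1) / sqrt 2) + Re w)\<^sup>2 + (s * ((y - c2) / sqrt 2) + Im w)\<^sup>2 < \<gamma>
      \<longleftrightarrow> x\<^sup>2 + y\<^sup>2 < (sqrt (2 * \<gamma>) / s)\<^sup>2" for x y
  proof -
    have lin: "s * ((x - sqrt 2 * b / s) / sqrt 2) + b = s * x / sqrt 2" for x b :: real
    proof -
      have "s * ((x - sqrt 2 * b / s) / sqrt 2) = (s * x - sqrt 2 * b) / sqrt 2"
        using s by (simp add: right_diff_distrib)
      then show ?thesis by (simp add: diff_divide_distrib)
    qed
    have 1: "(s * x / sqrt 2)\<^sup>2 + (s * y / sqrt 2)\<^sup>2 = s\<^sup>2 * (x\<^sup>2 + y\<^sup>2) / 2"
      by (simp add: power_divide power_mult_distrib distrib_left add_divide_distrib)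
    have 2: "(sqrt (2 * \<gamma>) / s)\<^sup>2 = 2 * \<gamma> / s\<^sup>2"
      using \<gamma> by (simp add: power_divide)
    show ?thesis
      unfolding c1_def c2_def lin 1 2 using s by (simp add: less_divide_eq mult.commute)
  qed
  have subst: "(\<integral>\<^sup>+x. g x \<partial>lborel) = (\<integral>\<^sup>+x. ennreal (1 / sqrt 2) * g ((x - c) / sqrt 2) \<partial>lborel)"
    if [measurable]: "g \<in> borel_measurable borel" for g :: "real \<Rightarrow> ennreal" and c
    by (subst nn_integral_real_affine[where c="1 / sqrt 2" and t="- c / sqrt 2"])
       (simp_all add: nn_integral_cmult diff_divide_distrib)
  have "emeasure M {\<omega> \<in> space M. (cmod (of_real s * Z \<omega> + w))\<^sup>2 < \<gamma>}
      = emeasure M ((\<lambda>\<omega>. (Re (Z \<omega>), Im (Z \<omega>))) -` A \<inter> space M)"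
    by (rule arg_cong[where f="emeasure M"]) (auto simp: A_def cmod_power2)
  also have "\<dots> = (\<integral>\<^sup>+p. (case p of (x, y) \<Rightarrow> ennreal (n x) * ennreal (n y)) * indicator A p \<partial>(lborel \<Otimes>\<^sub>M lborel))"
    by (rule distributed_emeasure[OF D A])
  also have "\<dots> = (\<integral>\<^sup>+x. \<integral>\<^sup>+y. ennreal (n x) * ennreal (n y) * indicator A (x, y) \<partial>lborel \<partial>lborel)"
    using A by (subst lborel.nn_integral_fst[symmetric]) auto
  also have "\<dots> = (\<integral>\<^sup>+x. \<integral>\<^sup>+y. ennreal (n x) * ennreal (n y) *
      indicator {..<\<gamma>} ((s * x + Re w)\<^sup>2 + (s * y + Im w)\<^sup>2) \<partial>lborel \<partial>lborel)"
    by (simp add: A_def indicator_def)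
  also have "\<dots> = (\<integral>\<^sup>+x. ennreal (1 / sqrt 2) * (\<integral>\<^sup>+y. ennreal (n ((x - c1) / sqrt 2)) * ennreal (n y) *
      indicator {..<\<gamma>} ((s * ((x - c1) / sqrt 2) + Re w)\<^sup>2 + (s * y + Im w)\<^sup>2) \<partial>lborel) \<partial>lborel)"
    by (rule subst) measurable
  also have "\<dots> = (\<integral>\<^sup>+x. ennreal (1 / sqrt 2) * (\<integral>\<^sup>+y. ennreal (1 / sqrt 2) * (ennreal (n ((x - c1) / sqrt 2)) * ennreal (n ((y - c2) / sqrt 2)) *
      indicator {..<\<gamma>} ((s * ((x - c1) / sqrt 2) + Re w)\<^sup>2 + (s * ((y - c2) / sqrt 2) + Im w)\<^sup>2)) \<partial>lborel) \<partial>lborel)"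
    by (intro nn_integral_cong arg_cong2[where f="(*)"] refl subst) measurable
  also have "\<dots> = (\<integral>\<^sup>+x. \<integral>\<^sup>+y. ennreal (std_normal_density (x - c1) * std_normal_density (y - c2)) *
      indicator {..<(sqrt (2 * \<gamma>) / s)\<^sup>2} (x\<^sup>2 + y\<^sup>2) \<partial>lborel \<partial>lborel)"
  proof (rule nn_integral_cong)
    fix x :: real
    have "ennreal (1 / sqrt 2) * (ennreal (1 / sqrt 2) * (ennreal (n ((x - c1) / sqrt 2)) * ennreal (n ((y - c2) / sqrt 2)) *
        indicator {..<\<gamma>} ((s * ((x - c1) / sqrt 2) + Re w)\<^sup>2 + (s * ((y - c2) / sqrt 2) + Im w)\<^sup>2)))
      = ennreal (std_normal_density (x - c1) * std_normal_density (y - c2)) *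
      indicator {..<(sqrt (2 * \<gamma>) / s)\<^sup>2} (x\<^sup>2 + y\<^sup>2)" for y
    proof -
      have "ennreal (1 / sqrt 2) * (ennreal (1 / sqrt 2) * (ennreal (n ((x - c1) / sqrt 2)) * ennreal (n ((y - c2) / sqrt 2))))
        = ennreal (n ((x - c1) / sqrt 2) / sqrt 2 * (n ((y - c2) / sqrt 2) / sqrt 2))"
        by (simp add: ennreal_mult[symmetric] n_nonneg)
      then show ?thesis
        unfolding n_shift indicator_def lessThan_iff dom by (simp only: mult.assoc[symmetric])
    qed
    then show "ennreal (1 / sqrt 2) * (\<integral>\<^sup>+y. ennreal (1 / sqrt 2) * (ennreal (n ((x - c1) / sqrt 2)) * ennreal (n ((y - c2) / sqrt 2)) *
      indicator {..<\<gamma>} ((s * ((x - c1) / sqrt 2) + Re w)\<^sup>2 + (s * ((y - c2) / sqrt 2) + Im w)\<^sup>2)) \<partial>lborel)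
      = (\<integral>\<^sup>+y. ennreal (std_normal_density (x - c1) * std_normal_density (y - c2)) *
      indicator {..<(sqrt (2 * \<gamma>) / s)\<^sup>2} (x\<^sup>2 + y\<^sup>2) \<partial>lborel)"
      by (subst nn_integral_cmult[symmetric]) simp_all
  qed
  also have "\<dots> = rice_cdf (sqrt (c1\<^sup>2 + c2\<^sup>2)) (sqrt (2 * \<gamma>) / s)"
    using s \<gamma> by (intro nn_integral_shifted_std_normal_disc) simp
  also have "sqrt (c1\<^sup>2 + c2\<^sup>2) = sqrt 2 * cmod w / s"
  proof -
    have "c1\<^sup>2 + c2\<^sup>2 = (sqrt 2 * cmod w / s)\<^sup>2"
      unfolding c1_def c2_def by (simp add: power_divide power_mult_distrib cmod_power2 distrib_left add_divide_distrib)
    then show ?thesis using s by simp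
  qed
  finally show ?thesis .
qed

text \<open>The joint law of a finite independent family is a product measure. Integrating over
  coordinate \<open>i\<close> last, the constraints on the others for a fixed value \<open>y\<close>
  cut out a box, whose measure is a product.\<close>

lemma (in prob_space) emeasure_indep_vars_condition:
  fixes X :: "'i \<Rightarrow> 'a \<Rightarrow> 'b::topological_space"
  assumes indep: "indep_vars (\<lambda>_. borel) X (insert i L)" and L: "finite L" "i \<notin> L"
    and B: "B \<in> sets borel" and A: "\<And>p. p \<in> L \<Longrightarrow> A p \<in> sets (borel \<Otimes>\<^sub>M borel)"
  shows "emeasure M {\<omega> \<in> space M. X i \<omega> \<in> B \<and> (\<forall>p\<in>L. (X i \<omega>, X p \<omega>) \<in> A p)}
    = (\<integral>\<^sup>+y\<in>B. (\<Prod>p\<in>L. emeasure M {\<omega> \<in> space M. (y, X p \<omega>) \<in> A p}) \<partial>distr M borel (X i))"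
proof -
  \<comment> \<open>\<open>product_prob_space\<close> asks for a probability measure at every index,
    while \<open>X p\<close> is known to be measurable only on \<open>insert i L\<close>; elsewhere
    the law of \<open>X i\<close> is the default.\<close>
  define N where "N = (\<lambda>p. if p \<in> insert i L then distr M borel (X p) else distr M borel (X i))"
  define E where "E = {x \<in> space (Pi\<^sub>M (insert i L) N). x i \<in> B \<and> (\<forall>p\<in>L. (x i, x p) \<in> A p)}"
  have rv: "random_variable borel (X p)" if "p \<in> insert i L" for p
    using indep that by (auto simp: indep_vars_def)
  have sets_N [measurable_cong]: "sets (N p) = sets borel" for p
    by (simp add: N_def)
  have prob_N: "prob_space (N p)" for p
    using rv by (auto simp: N_def intro!: prob_space_distr)
  interpret N: product_prob_space N
    by (intro product_prob_spaceI prob_N)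
  have space_N: "space (N p) = UNIV" for p
    by (simp add: N_def)
  have comp: "(\<lambda>x. x p) \<in> borel_measurable (Pi\<^sub>M (insert i L) N)" if "p \<in> insert i L" for p
    using measurable_component_singleton[OF that, of N] by (simp add: measurable_cong_sets[OF refl sets_N])
  have E: "E \<in> sets (Pi\<^sub>M (insert i L) N)"
    unfolding E_def
  proof (intro sets.sets_Collect_conj sets.sets_Collect_finite_All L)
    show "{x \<in> space (Pi\<^sub>M (insert i L) N). x i \<in> B} \<in> sets (Pi\<^sub>M (insert i L) N)"
      using measurable_sets[OF comp B, of i] by (simp add: vimage_def Int_def conj_commute)
    show "{x \<in> space (Pi\<^sub>M (insert i L) N). (x i, x p) \<in> A p} \<in> sets (Pi\<^sub>M (insert i L) N)" if "p \<in> L" for p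
      using measurable_sets[OF measurable_Pair[OF comp comp] A[OF that], of i p] that
      by (simp add: vimage_def Int_def conj_commute)
  qed
  have slice: "{x. (y, x) \<in> A p} \<in> sets borel" if "p \<in> L" for p y
    using sets_Pair1[OF A[OF that], of y] by (simp add: vimage_def)
  have N_L: "emeasure (N p) {x. (y, x) \<in> A p} = emeasure M {\<omega> \<in> space M. (y, X p \<omega>) \<in> A p}"
    if "p \<in> L" for p y
    using that rv[of p] slice[OF that, of y]
    by (simp add: N_def emeasure_distr vimage_def Int_def conj_commute)
  have joint: "(\<lambda>\<omega>. \<lambda>p\<in>insert i L. X p \<omega>) \<in> measurable M (\<Pi>\<^sub>M p\<in>insert i L. borel)"
    by (rule measurable_restrict) (rule rv)
  have sets_joint: "sets (Pi\<^sub>M (insert i L) N) = sets (\<Pi>\<^sub>M p\<in>insert i L. borel)"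
    by (rule sets_PiM_cong) (simp_all only: sets_N)
  have "emeasure M {\<omega> \<in> space M. X i \<omega> \<in> B \<and> (\<forall>p\<in>L. (X i \<omega>, X p \<omega>) \<in> A p)}
      = emeasure M ((\<lambda>\<omega>. \<lambda>p\<in>insert i L. X p \<omega>) -` E \<inter> space M)"
    by (rule arg_cong[where f="emeasure M"]) (auto simp: E_def space_PiM space_N)
  also have "\<dots> = emeasure (distr M (\<Pi>\<^sub>M p\<in>insert i L. borel) (\<lambda>\<omega>. \<lambda>p\<in>insert i L. X p \<omega>)) E"
    using E joint unfolding sets_joint by (rule emeasure_distr[symmetric, rotated])
  also have "distr M (\<Pi>\<^sub>M p\<in>insert i L. borel) (\<lambda>\<omega>. \<lambda>p\<in>insert i L. X p \<omega>) = Pi\<^sub>M (insert i L) N"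
  proof -
    have "Pi\<^sub>M (insert i L) N = (\<Pi>\<^sub>M p\<in>insert i L. distr M borel (X p))"
      by (rule PiM_cong) (simp_all add: N_def)
    then show ?thesis
      using indep rv by (simp add: indep_vars_iff_distr_eq_PiM')
  qed
  also have "emeasure (Pi\<^sub>M (insert i L) N) E = (\<integral>\<^sup>+x. indicator E x \<partial>Pi\<^sub>M (insert i L) N)"
    using E by simp
  \<comment> \<open>The variant \<open>insert_rev\<close> makes coordinate \<open>i\<close> the
    outer variable, which is the conditioning on \<open>X i = y\<close>.\<close>
  also have "\<dots> = (\<integral>\<^sup>+y. \<integral>\<^sup>+x. indicator E (x(i := y)) \<partial>Pi\<^sub>M L N \<partial>N i)"
    using L E by (intro N.product_nn_integral_insert_rev) auto
  also have "\<dots> = (\<integral>\<^sup>+y\<in>B. (\<Prod>p\<in>L. emeasure M {\<omega> \<in> space M. (y, X p \<omega>) \<in> A p}) \<partial>N i)"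
  proof (rule nn_integral_cong)
    fix y
    have PiE: "(\<Pi>\<^sub>E p\<in>L. {x. (y, x) \<in> A p}) \<in> sets (Pi\<^sub>M L N)"
      using slice by (intro sets_PiM_I_finite L) (simp add: sets_N)
    have "(\<integral>\<^sup>+x. indicator E (x(i := y)) \<partial>Pi\<^sub>M L N)
      = (\<integral>\<^sup>+x. indicator B y * indicator (\<Pi>\<^sub>E p\<in>L. {x. (y, x) \<in> A p}) x \<partial>Pi\<^sub>M L N)"
    proof (rule nn_integral_cong)
      fix x assume "x \<in> space (Pi\<^sub>M L N)"
      then have x: "x \<in> extensional L" by (simp add: space_PiM PiE_def)
      then have "x(i := y) \<in> extensional (insert i L)" by (auto simp: extensional_def)
      moreover have "(x(i := y)) p = x p" if "p \<in> L" for p using that L by auto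
      ultimately have "x(i := y) \<in> E \<longleftrightarrow> y \<in> B \<and> x \<in> (\<Pi>\<^sub>E p\<in>L. {x. (y, x) \<in> A p})"
        using x fun_upd_same[of x i y]
        by (auto simp: E_def space_PiM space_N PiE_def Pi_def simp del: fun_upd_apply fun_upd_same)
      then show "indicator E (x(i := y)) = (indicator B y * indicator (\<Pi>\<^sub>E p\<in>L. {x. (y, x) \<in> A p}) x :: ennreal)"
        by (simp add: indicator_def)
    qed
    also have "\<dots> = indicator B y * emeasure (Pi\<^sub>M L N) (\<Pi>\<^sub>E p\<in>L. {x. (y, x) \<in> A p})"
      using PiE by (simp add: nn_integral_cmult)
    also have "emeasure (Pi\<^sub>M L N) (\<Pi>\<^sub>E p\<in>L. {x. (y, x) \<in> A p})
      = (\<Prod>p\<in>L. emeasure (N p) {x. (y, x) \<in> A p})"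
      using L(1) slice by (intro N.emeasure_PiM) (simp_all add: sets_N)
    also have "\<dots> = (\<Prod>p\<in>L. emeasure M {\<omega> \<in> space M. (y, X p \<omega>) \<in> A p})"
      by (intro prod.cong N_L refl)
    finally show "(\<integral>\<^sup>+x. indicator E (x(i := y)) \<partial>Pi\<^sub>M L N)
      = (\<Prod>p\<in>L. emeasure M {\<omega> \<in> space M. (y, X p \<omega>) \<in> A p}) * indicator B y"
      by (simp add: mult.commute del: fun_upd_apply)
  qed
  also have "N i = distr M borel (X i)" by (simp add: N_def)
  finally show ?thesis .
qed

section \<open>Products over the grid and the outage bound\<close>

lemma prod_grid_minus_origin:
  fixes f :: "nat \<times> nat \<Rightarrow> 'a::comm_monoid_mult"
  assumes "1 \<le> m" "1 \<le> n"
  shows "(\<Prod>p\<in>{1..m} \<times> {1..n} - {(1, 1)}. f p)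
    = (\<Prod>i\<in>{2..m}. f (i, 1)) * (\<Prod>j\<in>{2..n}. f (1, j)) * (\<Prod>p\<in>{2..m} \<times> {2..n}. f p)"
proof -
  \<comment> \<open>Three disjoint pieces, one for each correlation coefficient: the edge with
    second index 1, the edge with first index 1, and the interior.\<close>
  have "{1..m} \<times> {1..n} - {(1, 1)} = ((\<lambda>i. (i, 1)) ` {2..m} \<union> Pair 1 ` {2..n}) \<union> {2..m} \<times> {2..n}"
    using assms by (auto simp: image_iff)
  also have "prod f \<dots> = prod f ((\<lambda>i. (i, 1)) ` {2..m}) * prod f (Pair 1 ` {2..n}) * prod f ({2..m} \<times> {2..n})"
    by (subst prod.union_disjoint; (subst prod.union_disjoint)?) auto
  finally show ?thesis
    by (simp add: prod.reindex inj_on_def)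
qed

lemma prod_mono_ennreal:
  fixes f g :: "'i \<Rightarrow> ennreal"
  assumes "\<And>i. i \<in> I \<Longrightarrow> f i \<le> g i"
  shows "prod f I \<le> prod g I"
  using assms by (induction I rule: infinite_finite_induct) (auto intro!: mult_mono)

theorem corollary5:
  fixes M :: "'a measure" and MR MT :: nat and \<rho>1 \<rho>2 \<gamma> :: real
    and z :: "nat \<times> nat \<Rightarrow> 'a \<Rightarrow> complex"
  assumes "prob_space M"
    and "MR \<ge> 1" and "MT \<ge> 1"
    and "\<bar>\<rho>1\<bar> < 1" and "\<bar>\<rho>2\<bar> < 1"
    and "prob_space.indep_vars M (\<lambda>_. borel) z ({1..MR} \<times> {1..MT})"
    and "\<And>i j. 1 \<le> i \<Longrightarrow> i \<le> MR \<Longrightarrow> 1 \<le> j \<Longrightarrow> j \<le> MT \<Longrightarrow> circ_sym_complex_gaussian M 1 (z (i, j))"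
    and "\<gamma> > 0"
  shows "outage_prob M MR MT (fas_channel \<rho>1 \<rho>2 z) \<gamma> \<ge>
    (1 - exp (- \<gamma>)) *
    (1 - marcum_Q1 (sqrt (2 * \<rho>1\<^sup>2 * \<gamma> / (1 - \<rho>1\<^sup>2))) (sqrt (2 * \<gamma> / (1 - \<rho>1\<^sup>2)))) ^ (MR - 1) *
    (1 - marcum_Q1 (sqrt (2 * \<rho>2\<^sup>2 * \<gamma> / (1 - \<rho>2\<^sup>2))) (sqrt (2 * \<gamma> / (1 - \<rho>2\<^sup>2)))) ^ (MT - 1) *
    (1 - marcum_Q1 (sqrt (2 * \<rho>1\<^sup>2 * \<rho>2\<^sup>2 * \<gamma> / (1 - \<rho>1\<^sup>2 * \<rho>2\<^sup>2)))
                   (sqrt (2 * \<gamma> / (1 - \<rho>1\<^sup>2 * \<rho>2\<^sup>2)))) ^ ((MR - 1) * (MT - 1))"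
proof -
  interpret prob_space M by fact
  define I where "I = {1..MR} \<times> {1..MT}"
  define L where "L = I - {(1, 1)}"
  \<comment> \<open>A single coefficient for the three cases off the origin: the channel at
    \<open>p\<close> is \<open>s p * z p + \<rho> p * z (1, 1)\<close>. At \<open>(1, 1)\<close> the
    value is \<open>\<rho>1\<close>, so \<open>(\<rho> p)\<^sup>2 < 1\<close> holds for every
    \<open>p\<close>.\<close>
  define \<rho> where "\<rho> = (\<lambda>p :: nat \<times> nat. if snd p = 1 then \<rho>1 else if fst p = 1 then \<rho>2 else \<rho>1 * \<rho>2)"
  define s where "s = (\<lambda>p. sqrt (1 - (\<rho> p)\<^sup>2))"
  define Q where "Q = (\<lambda>r. marcum_Q1 (sqrt (2 * r\<^sup>2 * \<gamma> / (1 - r\<^sup>2))) (sqrt (2 * \<gamma> / (1 - r\<^sup>2))))"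
  define A where "A = (\<lambda>p. {(y, x). (cmod (of_real (s p) * x + of_real (\<rho> p) * y))\<^sup>2 < \<gamma>})"
  define B where "B = {y::complex. (cmod y)\<^sup>2 < \<gamma>}"
  have I: "I = insert (1, 1) L" and L: "finite L" "(1, 1) \<notin> L"
    using assms(2,3) unfolding I_def L_def by auto
  have gauss: "circ_sym_complex_gaussian M 1 (z p)" if "p \<in> I" for p
    using assms(7) that by (cases p) (auto simp: I_def)
  have \<rho>12: "\<bar>\<rho>1 * \<rho>2\<bar> < 1"
    using mult_strict_mono'[of "\<bar>\<rho>1\<bar>" 1 "\<bar>\<rho>2\<bar>" 1] assms(4,5) by (simp add: abs_mult)
  have \<rho>_lt: "(\<rho> p)\<^sup>2 < 1" for p
    using assms(4,5) \<rho>12 by (auto simp: \<rho>_def abs_square_less_1)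
  have s_pos: "0 < s p" for p
    unfolding s_def using \<rho>_lt[of p] by simp
  have Q_le: "Q (\<rho> p) \<le> 1" for p
    unfolding Q_def using \<rho>_lt[of p] assms(8) by (intro rice_cdf_eq_marcum_Q1(2)) auto
  have B: "B \<in> sets borel"
    unfolding B_def by measurable
  have A: "A p \<in> sets (borel \<Otimes>\<^sub>M borel)" for p
  proof -
    have "(\<lambda>q. (cmod (of_real (s p) * snd q + of_real (\<rho> p) * fst q))\<^sup>2) \<in> borel_measurable (borel \<Otimes>\<^sub>M borel)"
      by measurable
    from borel_measurable_iff_less[THEN iffD1, OF this, rule_format, of \<gamma>] show ?thesis
      by (simp add: A_def space_pair_measure case_prod_beta')
  qed
  \<comment> \<open>On \<open>B\<close> the shift \<open>\<rho> p * y\<close> has modulus at most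
    \<open>\<bar>\<rho> p\<bar> * sqrt \<gamma>\<close>. The arguments of \<open>Q\<close> are the
    rescaled shift and radius at this extreme, and \<open>rice_cdf\<close> decreases in the
    shift.\<close>
  have factor: "ennreal (1 - Q (\<rho> p)) \<le> emeasure M {\<omega> \<in> space M. (y, z p \<omega>) \<in> A p}"
    if "p \<in> L" "y \<in> B" for p y
  proof -
    have "cmod (of_real (\<rho> p) * y) \<le> \<bar>\<rho> p\<bar> * sqrt \<gamma>"
      using that(2) by (auto simp: B_def norm_mult intro!: mult_left_mono real_le_rsqrt)
    then have le: "sqrt 2 * cmod (of_real (\<rho> p) * y) / s p \<le> sqrt 2 * (\<bar>\<rho> p\<bar> * sqrt \<gamma>) / s p"
      using s_pos[of p] by (intro divide_right_mono mult_left_mono) auto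
    have "ennreal (1 - Q (\<rho> p)) = rice_cdf (sqrt 2 * (\<bar>\<rho> p\<bar> * sqrt \<gamma>) / s p) (sqrt (2 * \<gamma>) / s p)"
      unfolding Q_def s_def using \<rho>_lt[of p] assms(8)
      by (subst rice_cdf_eq_marcum_Q1(1)[symmetric]) (auto simp: real_sqrt_mult real_sqrt_divide mult.assoc)
    also have "\<dots> \<le> rice_cdf (sqrt 2 * cmod (of_real (\<rho> p) * y) / s p) (sqrt (2 * \<gamma>) / s p)"
      using s_pos[of p] assms(8) by (intro rice_cdf_antimono le) auto
    also have "\<dots> = emeasure M {\<omega> \<in> space M. (cmod (of_real (s p) * z p \<omega> + of_real (\<rho> p) * y))\<^sup>2 < \<gamma>}"
      using that s_pos[of p] assms(8) by (intro emeasure_circ_sym_complex_gaussian_disc[symmetric] gauss) (auto simp: I)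
    finally show ?thesis by (simp add: A_def)
  qed
  \<comment> \<open>The reference variable is the case of scale 1 and shift 0 of the disc
    formula.\<close>
  have "emeasure M {\<omega> \<in> space M. (cmod (of_real 1 * z (1, 1) \<omega> + 0))\<^sup>2 < \<gamma>} = rice_cdf (sqrt 2 * cmod 0 / 1) (sqrt (2 * \<gamma>) / 1)"
    using assms(8) by (intro emeasure_circ_sym_complex_gaussian_disc gauss) (auto simp: I)
  also have "\<dots> = ennreal (1 - exp (- \<gamma>))"
    using assms(8) by (simp add: rice_cdf_0)
  finally have "emeasure M {\<omega> \<in> space M. z (1, 1) \<omega> \<in> B} = ennreal (1 - exp (- \<gamma>))"
    by (simp add: B_def)
  moreover have rv0: "random_variable borel (z (1, 1))"
    using assms(6) I unfolding I_def by (auto simp: indep_vars_def)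
  ultimately have ref: "emeasure (distr M borel (z (1, 1))) B = ennreal (1 - exp (- \<gamma>))"
    using B by (simp add: emeasure_distr vimage_def Int_def conj_commute)
  have channel: "fas_channel \<rho>1 \<rho>2 z p \<omega> = of_real (s p) * z p \<omega> + of_real (\<rho> p) * z (1, 1) \<omega>"
    if "p \<in> L" for p \<omega>
    using that by (cases p) (auto simp: fas_channel_def s_def \<rho>_def L_def power_mult_distrib)
  have channel0: "fas_channel \<rho>1 \<rho>2 z (1, 1) \<omega> = z (1, 1) \<omega>" for \<omega>
    by (simp add: fas_channel_def)
  have gain: "(fas_gain MR MT (fas_channel \<rho>1 \<rho>2 z) \<omega>)\<^sup>2 < \<gamma>
      \<longleftrightarrow> z (1, 1) \<omega> \<in> B \<and> (\<forall>p\<in>L. (z (1, 1) \<omega>, z p \<omega>) \<in> A p)" for \<omega>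
  proof -
    define h where "h = (\<lambda>p. cmod (fas_channel \<rho>1 \<rho>2 z p \<omega>))"
    have fin: "finite (h ` I)" "h ` I \<noteq> {}" using I L(1) by auto
    have gain_eq: "fas_gain MR MT (fas_channel \<rho>1 \<rho>2 z) \<omega> = Max (h ` I)"
      by (simp add: fas_gain_def h_def I_def)
    have sq: "x\<^sup>2 < \<gamma> \<longleftrightarrow> x < sqrt \<gamma>" if "0 \<le> x" for x
      using real_sqrt_less_iff[of "x\<^sup>2" \<gamma>] that by simp
    \<comment> \<open>Replacing the squared comparison by one with \<open>sqrt \<gamma>\<close>
      requires the maximum to be nonnegative; the entry at the origin ensures this.\<close>
    have "0 \<le> h (1, 1)" by (simp add: h_def)
    also have "\<dots> \<le> Max (h ` I)" using fin by (intro Max_ge) (auto simp: I)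
    finally have "(Max (h ` I))\<^sup>2 < \<gamma> \<longleftrightarrow> (\<forall>p\<in>I. h p < sqrt \<gamma>)"
      using fin by (simp add: sq)
    also have "\<dots> \<longleftrightarrow> (\<forall>p\<in>I. (h p)\<^sup>2 < \<gamma>)"
      by (simp add: sq h_def)
    also have "\<dots> \<longleftrightarrow> z (1, 1) \<omega> \<in> B \<and> (\<forall>p\<in>L. (z (1, 1) \<omega>, z p \<omega>) \<in> A p)"
      unfolding I h_def B_def A_def using channel0[of \<omega>] by (auto simp: channel)
    finally show ?thesis unfolding gain_eq .
  qed
  define C where "C = (\<Prod>p\<in>L. 1 - Q (\<rho> p))"
  have C: "0 \<le> C" unfolding C_def using Q_le by (intro prod_nonneg) auto
  \<comment> \<open>The bound is written as the integral of the constant \<open>C\<close> over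
    \<open>B\<close>, so that it can be compared pointwise in \<open>y\<close> with the product of
    conditional probabilities.\<close>
  have "ennreal ((1 - exp (- \<gamma>)) * C) = (\<integral>\<^sup>+y\<in>B. ennreal C \<partial>distr M borel (z (1, 1)))"
    using B assms(8) C by (subst nn_integral_cmult_indicator) (auto simp: ref ennreal_mult mult.commute simp del: One_nat_def)
  also have "\<dots> \<le> (\<integral>\<^sup>+y\<in>B. (\<Prod>p\<in>L. emeasure M {\<omega> \<in> space M. (y, z p \<omega>) \<in> A p}) \<partial>distr M borel (z (1, 1)))"
  proof (rule nn_integral_mono)
    fix y
    have "ennreal C \<le> (\<Prod>p\<in>L. emeasure M {\<omega> \<in> space M. (y, z p \<omega>) \<in> A p})" if "y \<in> B"
      unfolding C_def using Q_le factor[OF _ that]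
      by (subst prod_ennreal[symmetric]) (auto intro!: prod_mono_ennreal)
    then show "ennreal C * indicator B y \<le> (\<Prod>p\<in>L. emeasure M {\<omega> \<in> space M. (y, z p \<omega>) \<in> A p}) * indicator B y"
      by (simp add: indicator_def)
  qed
  also have "\<dots> = emeasure M {\<omega> \<in> space M. z (1, 1) \<omega> \<in> B \<and> (\<forall>p\<in>L. (z (1, 1) \<omega>, z p \<omega>) \<in> A p)}"
    using assms(6) L A B unfolding I_def[symmetric] I
    by (intro emeasure_indep_vars_condition[symmetric]) auto
  also have "\<dots> = ennreal (outage_prob M MR MT (fas_channel \<rho>1 \<rho>2 z) \<gamma>)"
    unfolding outage_prob_def gain by (rule emeasure_eq_measure)
  finally have "(1 - exp (- \<gamma>)) * C \<le> outage_prob M MR MT (fas_channel \<rho>1 \<rho>2 z) \<gamma>"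
    by (simp add: outage_prob_def)
  moreover have "C = (1 - Q \<rho>1) ^ (MR - 1) * (1 - Q \<rho>2) ^ (MT - 1) * (1 - Q (\<rho>1 * \<rho>2)) ^ ((MR - 1) * (MT - 1))"
  proof -
    have "(\<Prod>i\<in>{2..MR}. 1 - Q (\<rho> (i, 1))) = (1 - Q \<rho>1) ^ (MR - 1)"
      by (simp add: \<rho>_def)
    moreover have "(\<Prod>j\<in>{2..MT}. 1 - Q (\<rho> (1, j))) = (1 - Q \<rho>2) ^ (MT - 1)"
    proof -
      have "(\<Prod>j\<in>{2..MT}. 1 - Q (\<rho> (1, j))) = (\<Prod>j\<in>{2..MT}. 1 - Q \<rho>2)"
        by (intro prod.cong) (auto simp: \<rho>_def)
      then show ?thesis by simp
    qed
    moreover have "(\<Prod>p\<in>{2..MR} \<times> {2..MT}. 1 - Q (\<rho> p)) = (1 - Q (\<rho>1 * \<rho>2)) ^ ((MR - 1) * (MT - 1))"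
    proof -
      have "(\<Prod>p\<in>{2..MR} \<times> {2..MT}. 1 - Q (\<rho> p)) = (\<Prod>p\<in>{2..MR} \<times> {2..MT}. 1 - Q (\<rho>1 * \<rho>2))"
        by (intro prod.cong) (auto simp: \<rho>_def)
      then show ?thesis by (simp add: card_cartesian_product)
    qed
    ultimately show ?thesis
      unfolding C_def L_def I_def using assms(2,3) by (simp only: prod_grid_minus_origin)
  qed
  ultimately show ?thesis
    by (simp only: Q_def power_mult_distrib mult.assoc)
qed

end
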